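(* If $B$ is a binary $r\times c$ matrix with $w(B)>r+c-1$, then $\mathrm{ex}(B,n)=\Omega(n^{1+\epsilon})$ as $n\to\infty$ for some $\epsilon>0$.
   Context: All matrices are binary (entries $0$ or $1$). $w(B)$ is the number of $1$-entries of $B$. A matrix $A$ represents a matrix $B$ of the same dimensions if $B$ can be obtained from $A$ by changing some (possibly no) $1$-entries of $A$ to $0$. $A$ contains $B$ if some submatrix of $A$ (obtained by choosing a subset of the rows and a subset of the columns, keeping their order) represents $B$; otherwise $A$ avoids $B$. $\mathrm{ex}(B,n)$ is the maximum number of $1$-entries in an $n\times n$ binary matrix that avoids $B$. Both $\epsilon$ and the implied constant may depend on $B$. *)

theory Defs
  imports
    "HOL-Library.Landau_Symbols"
    "HOL-Library.Z2"
    "Jordan_Normal_Form.DL_Submatrix"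
begin

text \<open>
  Binary matrices are matrices over the two-element type \<^typ>\<open>bit\<close>; only the values 0 and 1
  of this type matter, its arithmetic is never used.
\<close>

definition ones :: "bit mat \<Rightarrow> (nat \<times> nat) set" where
  "ones A = {(i, j). i < dim_row A \<and> j < dim_col A \<and> A $$ (i, j) = 1}"

definition weight :: "bit mat \<Rightarrow> nat" where
  "weight A = card (ones A)"

definition represents :: "bit mat \<Rightarrow> bit mat \<Rightarrow> bool" where
  "represents A B \<longleftrightarrow>
     (\<exists>S \<subseteq> ones A. B = mat (dim_row A) (dim_col A) (\<lambda>p. if p \<in> S then 0 else A $$ p))"

definition contains :: "bit mat \<Rightarrow> bit mat \<Rightarrow> bool" where
  "contains A B \<longleftrightarrow>
     (\<exists>I \<subseteq> {..<dim_row A}. \<exists>J \<subseteq> {..<dim_col A}. represents (submatrix A I J) B)"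

abbreviation avoids :: "bit mat \<Rightarrow> bit mat \<Rightarrow> bool" where
  "avoids A B \<equiv> \<not> contains A B"

text \<open>
  The maximum is over a finite set, which is nonempty whenever \<open>B\<close> has a 1-entry, since the
  zero matrix then avoids \<open>B\<close>. Otherwise the set may be empty and the value is unspecified.
\<close>

definition ex_mat :: "bit mat \<Rightarrow> nat \<Rightarrow> nat" where
  "ex_mat B n = Max (weight ` {A \<in> carrier_mat n n. avoids A B})"

end

theory Submission
  imports Defs
begin

text \<open>
  Deletion method. Choose every position of an \<open>n \<times> n\<close> matrix independently with probability
  \<open>p\<close>. With \<open>k = r + c \<le> weight B\<close>, the expected number of 1-entries minus the expected number
  of copies of \<open>B\<close> is at least \<open>p n\<^sup>2 - n\<^sup>k p\<^sup>k\<close>, which for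
  \<open>p = n powr (1 / (k - 1)) / (2 n)\<close> is of order \<open>n powr (1 + 1 / (k - 1))\<close>. Deleting one
  1-entry from every copy leaves a matrix that avoids \<open>B\<close>.
\<close>

text \<open>
  The expectation is a multi-affine polynomial in the probabilities, so each probability can be
  moved in turn to 0 or 1 without decreasing it. This replaces the probability space.
\<close>

lemma rounding:
  fixes p :: real
  assumes fin: "finite E" and finH: "finite H" and sub: "\<And>h. h \<in> H \<Longrightarrow> h \<subseteq> E"
    and p: "0 \<le> p" "p \<le> 1"
  obtains S where "S \<subseteq> E"
    "real (card E) * p - (\<Sum>h\<in>H. p ^ card h) \<le> real (card S) - real (card {h \<in> H. h \<subseteq> S})"
proof -
  \<comment> \<open>If every \<open>e\<close> is chosen independently with probability
    \<open>x e\<close>, then \<open>\<phi> x\<close> is the expected number of chosen elements minus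
    the expected number of sets in \<open>H\<close> that are chosen entirely.\<close>
  define \<phi> :: "('a \<Rightarrow> real) \<Rightarrow> real"
    where "\<phi> x = (\<Sum>e\<in>E. x e) - (\<Sum>h\<in>H. \<Prod>e\<in>h. x e)" for x
  have finh: "finite h" if "h \<in> H" for h
    using sub[OF that] fin finite_subset by blast
  \<comment> \<open>Each \<open>h\<close> is a set, so \<open>x a\<close> enters each product to at
    most the first power.\<close>
  have affine: "\<phi> (x(a := t)) = (1 - t) * \<phi> (x(a := 0)) + t * \<phi> (x(a := 1))" if "a \<in> E" for x a t
  proof -
    have s: "(\<Sum>e\<in>E. (x(a := u)) e) = u + (\<Sum>e\<in>E - {a}. x e)" for u
      using fin that by (simp add: sum.remove)
    have pr: "(\<Prod>e\<in>h. (x(a := t)) e) =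
        (1 - t) * (\<Prod>e\<in>h. (x(a := 0)) e) + t * (\<Prod>e\<in>h. (x(a := 1)) e)" if "h \<in> H" for h
    proof (cases "a \<in> h")
      case True
      then have "(\<Prod>e\<in>h. (x(a := u)) e) = u * (\<Prod>e\<in>h - {a}. x e)" for u
        using finh[OF that] by (simp add: prod.remove)
      then show ?thesis by simp
    next
      case False
      then have "(\<Prod>e\<in>h. (x(a := u)) e) = (\<Prod>e\<in>h. x e)" for u
        by (intro prod.cong) auto
      then show ?thesis by (simp add: algebra_simps)
    qed
    have "(\<Sum>h\<in>H. \<Prod>e\<in>h. (x(a := t)) e) =
        (1 - t) * (\<Sum>h\<in>H. \<Prod>e\<in>h. (x(a := 0)) e) + t * (\<Sum>h\<in>H. \<Prod>e\<in>h. (x(a := 1)) e)"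
      using pr by (simp add: sum.distrib sum_distrib_left del: fun_upd_apply cong: sum.cong)
    then show ?thesis
      unfolding \<phi>_def s by (simp add: algebra_simps del: fun_upd_apply)
  qed
  \<comment> \<open>\<open>F\<close> collects the coordinates already rounded. That the others still
    equal \<open>p\<close> is part of the induction claim, so that \<open>x\<close> can be read as
    \<open>x(a := p)\<close> when \<open>a\<close> is rounded.\<close>
  have "\<exists>x. (\<forall>e\<in>F. x e \<in> {0, 1}) \<and> (\<forall>e. e \<notin> F \<longrightarrow> x e = p) \<and> \<phi> (\<lambda>_. p) \<le> \<phi> x"
    if "finite F" "F \<subseteq> E" for F
    using that
  proof (induction F rule: finite_induct)
    case empty
    show ?case by (intro exI[of _ "\<lambda>_. p"]) auto
  next
    case (insert a F)
    then obtain x where x: "\<forall>e\<in>F. x e \<in> {0, 1}" "\<forall>e. e \<notin> F \<longrightarrow> x e = p" "\<phi> (\<lambda>_. p) \<le> \<phi> x"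
      by auto
    have "x(a := p) = x" using x(2) insert.hyps by auto
    then have "\<phi> x = (1 - p) * \<phi> (x(a := 0)) + p * \<phi> (x(a := 1))"
      using affine[of a x p] insert.prems by simp
    \<comment> \<open>A convex combination is at most the larger of its two values, so one of the
      choices 0 and 1 does not decrease \<open>\<phi>\<close>.\<close>
    also have "\<dots> \<le> max (\<phi> (x(a := 0))) (\<phi> (x(a := 1)))"
      using p by (intro convex_bound_le) auto
    finally obtain t where t: "t \<in> {0, 1}" "\<phi> x \<le> \<phi> (x(a := t))"
      by (auto simp: max_def split: if_splits)
    have "(\<forall>e\<in>insert a F. (x(a := t)) e \<in> {0, 1}) \<and> (\<forall>e. e \<notin> insert a F \<longrightarrow> (x(a := t)) e = p)"
      using x(1,2) t(1) by auto
    with order.trans[OF x(3) t(2)] show ?case by blast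
  qed
  from this[OF fin order.refl] obtain x
    where x: "\<forall>e\<in>E. x e \<in> {0, 1}" "\<phi> (\<lambda>_. p) \<le> \<phi> x" by blast
  define S where "S = {e \<in> E. x e = 1}"
  have "(\<Sum>e\<in>E. x e) = (\<Sum>e\<in>E. if e \<in> S then 1 else 0)"
    using x(1) by (intro sum.cong) (auto simp: S_def)
  also have "\<dots> = real (card S)"
    using fin by (simp add: S_def flip: sum.inter_filter)
  finally have 1: "(\<Sum>e\<in>E. x e) = real (card S)" .
  have "(\<Prod>e\<in>h. x e) = (if h \<subseteq> S then 1 else 0)" if "h \<in> H" for h
  proof (cases "h \<subseteq> S")
    case True
    then show ?thesis by (auto simp: S_def intro!: prod.neutral)
  next
    case False
    then obtain e where "e \<in> h" "x e = 0" using x(1) sub[OF \<open>h \<in> H\<close>] by (auto simp: S_def)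
    then show ?thesis using False finh[OF that] by auto
  qed
  then have "(\<Sum>h\<in>H. \<Prod>e\<in>h. x e) = (\<Sum>h\<in>H. if h \<subseteq> S then 1 else 0)"
    by (intro sum.cong) auto
  also have "\<dots> = real (card {h \<in> H. h \<subseteq> S})"
    using finH by (simp flip: sum.inter_filter)
  finally show ?thesis
    using x(2) 1 by (intro that[of S]) (auto simp: \<phi>_def S_def)
qed

text \<open>Removing one element from each \<open>h\<close> that lies inside the rounded set
  destroys all of these \<open>h\<close> and costs at most one element apiece.\<close>

lemma independent_set:
  fixes p :: real
  assumes fin: "finite E" and finH: "finite H"
    and sub: "\<And>h. h \<in> H \<Longrightarrow> h \<subseteq> E" and ne: "{} \<notin> H"
    and p: "0 \<le> p" "p \<le> 1"
  obtains S where "S \<subseteq> E" "\<And>h. h \<in> H \<Longrightarrow> \<not> h \<subseteq> S"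
    "real (card E) * p - (\<Sum>h\<in>H. p ^ card h) \<le> real (card S)"
proof -
  obtain S where S: "S \<subseteq> E"
    "real (card E) * p - (\<Sum>h\<in>H. p ^ card h) \<le> real (card S) - real (card {h \<in> H. h \<subseteq> S})"
    by (rule rounding[OF fin finH sub p])
  define T where "T = (\<lambda>h. SOME e. e \<in> h) ` {h \<in> H. h \<subseteq> S}"
  have T: "(SOME e. e \<in> h) \<in> h" if "h \<in> H" for h
    using that ne by (metis some_in_eq)
  have "card T \<le> card {h \<in> H. h \<subseteq> S}"
    unfolding T_def using finH by (intro card_image_le) auto
  moreover have "card S - card T \<le> card (S - T)"
    using finH by (intro diff_card_le_card_Diff) (auto simp: T_def)
  ultimately have "real (card S) - real (card {h \<in> H. h \<subseteq> S}) \<le> real (card (S - T))"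
    by linarith
  moreover have "\<not> h \<subseteq> S - T" if "h \<in> H" for h
    using T[OF that] that by (auto simp: T_def)
  ultimately show ?thesis
    using S by (intro that[of "S - T"]) auto
qed

text \<open>The positions taken by the 1-entries of \<open>B\<close> when its rows and columns are
  laid on \<open>I\<close> and \<open>J\<close> in order. As a set of positions it can serve as an
  \<open>h\<close> in \<open>independent_set\<close>.\<close>

definition copy :: "bit mat \<Rightarrow> nat set \<Rightarrow> nat set \<Rightarrow> (nat \<times> nat) set" where
  "copy B I J = map_prod (pick I) (pick J) ` ones B"

text \<open>Exactly \<open>i\<close> elements of \<open>S\<close> lie below \<open>pick S i\<close>,
  so counting them recovers \<open>i\<close>.\<close>

lemma inj_on_pick: "inj_on (pick S) {..<card S}"
  by (rule inj_on_inverseI[of _ "\<lambda>m. card {a \<in> S. a < m}"]) (simp add: card_pick_le)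

lemma card_copy:
  assumes "B \<in> carrier_mat (card I) (card J)"
  shows "card (copy B I J) = weight B"
proof -
  have "ones B \<subseteq> {..<card I} \<times> {..<card J}"
    using assms by (auto simp: ones_def)
  moreover have "inj_on (map_prod (pick I) (pick J)) ({..<card I} \<times> {..<card J})"
    by (intro map_prod_inj_on inj_on_pick)
  ultimately have "inj_on (map_prod (pick I) (pick J)) (ones B)"
    by (rule inj_on_subset[rotated])
  then show ?thesis by (simp add: copy_def weight_def card_image)
qed

lemma copy_subset:
  assumes "I \<subseteq> {..<m}" "J \<subseteq> {..<n}" "B \<in> carrier_mat (card I) (card J)"
  shows "copy B I J \<subseteq> {..<m} \<times> {..<n}"
proof -
  have "pick I i < m" if "i < card I" for i
    using pick_in_set_le[OF that] assms(1) by auto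
  moreover have "pick J j < n" if "j < card J" for j
    using pick_in_set_le[OF that] assms(2) by auto
  ultimately show ?thesis using assms(3) by (auto simp: copy_def ones_def)
qed

text \<open>Representation only turns 1 into 0, so each 1-entry of \<open>B\<close> comes from a
  1-entry of the submatrix, and \<open>pick\<close> locates that entry in \<open>A\<close>.\<close>

lemma contains_imp_copy:
  assumes "contains A B"
  obtains I J where "I \<subseteq> {..<dim_row A}" "J \<subseteq> {..<dim_col A}"
    "B \<in> carrier_mat (card I) (card J)" "copy B I J \<subseteq> ones A"
proof -
  from assms obtain I J S where I: "I \<subseteq> {..<dim_row A}" and J: "J \<subseteq> {..<dim_col A}"
    and B: "B = mat (dim_row (submatrix A I J)) (dim_col (submatrix A I J))
      (\<lambda>p. if p \<in> S then 0 else submatrix A I J $$ p)"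
    unfolding contains_def represents_def by blast
  have *: "{i. i < dim_row A \<and> i \<in> I} = I" "{i. i < dim_col A \<and> i \<in> J} = J"
    using I J by auto
  have d: "dim_row (submatrix A I J) = card I" "dim_col (submatrix A I J) = card J"
    by (simp_all add: dim_submatrix *)
  have "copy B I J \<subseteq> ones A"
  proof
    fix q assume "q \<in> copy B I J"
    then obtain i j where q: "q = (pick I i, pick J j)" and ij: "(i, j) \<in> ones B"
      by (auto simp: copy_def)
    have i: "i < card I" "j < card J"
      using ij d B by (auto simp: ones_def)
    have "B $$ (i, j) = 1" using ij by (simp add: ones_def)
    then have "submatrix A I J $$ (i, j) = 1"
      using B i d by (auto split: if_splits)
    then have "A $$ q = 1"
      using i by (simp add: submatrix_index * q)
    moreover have "pick I i < dim_row A" "pick J j < dim_col A"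
      using pick_in_set_le i I J by blast+
    ultimately show "q \<in> ones A" by (simp add: ones_def q)
  qed
  moreover have "B \<in> carrier_mat (card I) (card J)"
    using B d by auto
  ultimately show ?thesis using I J that by blast
qed

text \<open>A weight is at most \<open>n * n\<close>, so the maximum is over a finite set.\<close>

lemma weight_le_ex_mat:
  assumes "A \<in> carrier_mat n n" "avoids A B"
  shows "weight A \<le> ex_mat B n"
proof -
  have "weight A' \<le> n * n" if "A' \<in> carrier_mat n n" for A'
  proof -
    have "ones A' \<subseteq> {..<n} \<times> {..<n}" using that by (auto simp: ones_def)
    then have "card (ones A') \<le> card ({..<n} \<times> {..<n})" by (intro card_mono) auto
    then show ?thesis by (simp add: weight_def)
  qed
  then have "weight ` {A \<in> carrier_mat n n. avoids A B} \<subseteq> {..n * n}"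
    by blast
  then have "finite (weight ` {A \<in> carrier_mat n n. avoids A B})"
    by (rule finite_subset) simp
  moreover have "weight A \<in> weight ` {A \<in> carrier_mat n n. avoids A B}"
    using assms by blast
  ultimately show ?thesis
    unfolding ex_mat_def by (rule Max_ge)
qed

lemma binomial_le_power: "n choose k \<le> n ^ k"
proof (cases "k \<le> n")
  case True
  then show ?thesis by (rule binomial_le_pow)
qed (simp add: binomial_eq_0)

text \<open>\<open>independent_set\<close> is applied to the positions of an
  \<open>n \<times> n\<close> matrix, with all copies of \<open>B\<close> as the forbidden sets.
  Positive weight makes these sets nonempty.\<close>

lemma ex_mat_lower_bound:
  fixes p :: real
  assumes B: "B \<in> carrier_mat r c" and w: "weight B > 0" and p: "0 \<le> p" "p \<le> 1"
  shows "real n ^ 2 * p - real n ^ (r + c) * p ^ weight B \<le> real (ex_mat B n)"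
proof -
  define P where "P = {I. I \<subseteq> {..<n} \<and> card I = r} \<times> {J. J \<subseteq> {..<n} \<and> card J = c}"
  \<comment> \<open>Different pairs may give the same copy, for instance if \<open>B\<close> has a
    zero row, so \<open>card H\<close> is only bounded by \<open>card P\<close>.\<close>
  define H where "H = (\<lambda>(I, J). copy B I J) ` P"
  have finP: "finite P" unfolding P_def by (intro finite_cartesian_product) auto
  have "card P = (n choose r) * (n choose c)"
    by (simp add: P_def card_cartesian_product n_subsets)
  also have "\<dots> \<le> n ^ r * n ^ c"
    by (intro mult_le_mono binomial_le_power)
  finally have cardH: "card H \<le> n ^ (r + c)"
    unfolding H_def using card_image_le[OF finP] by (metis le_trans power_add)
  have finH: "finite H" using finP by (simp add: H_def)
  have cardh: "card h = weight B" if "h \<in> H" for h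
    using that B by (auto simp: H_def P_def intro!: card_copy)
  have sub: "h \<subseteq> {..<n} \<times> {..<n}" if "h \<in> H" for h
    using that B copy_subset[of _ n _ n B] unfolding H_def P_def by blast
  have ne: "{} \<notin> H" using cardh w by force
  obtain S where S: "S \<subseteq> {..<n} \<times> {..<n}" "\<And>h. h \<in> H \<Longrightarrow> \<not> h \<subseteq> S"
    "real (card ({..<n} \<times> {..<n})) * p - (\<Sum>h\<in>H. p ^ card h) \<le> real (card S)"
    using independent_set[OF _ finH sub ne p] by blast
  define A :: "bit mat" where "A = mat n n (\<lambda>q. if q \<in> S then 1 else 0)"
  have A: "A \<in> carrier_mat n n" by (simp add: A_def)
  have ones: "ones A = S" using S(1) by (auto simp: A_def ones_def split: if_splits)
  have "avoids A B"
  proof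
    assume "contains A B"
    then obtain I J where IJ: "I \<subseteq> {..<n}" "J \<subseteq> {..<n}" "B \<in> carrier_mat (card I) (card J)"
      "copy B I J \<subseteq> S"
      using contains_imp_copy[of A B] ones A by auto
    then have "(I, J) \<in> P" using B by (auto simp: P_def)
    then show False using IJ(4) S(2) by (auto simp: H_def)
  qed
  then have "card S \<le> ex_mat B n"
    using weight_le_ex_mat[OF A] ones by (simp add: weight_def)
  moreover have "(\<Sum>h\<in>H. p ^ card h) = real (card H) * p ^ weight B"
    using cardh by simp
  moreover have "real (card H) * p ^ weight B \<le> real n ^ (r + c) * p ^ weight B"
    using cardH p by (intro mult_right_mono) (simp_all flip: of_nat_power)
  ultimately show ?thesis
    using S(3) by (simp add: power2_eq_square)
qed

theorem corollary4p2:
  fixes B :: "bit mat" and r c :: nat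
  assumes "r \<ge> 1" and "c \<ge> 1"
    and "B \<in> carrier_mat r c"
    and "weight B > r + c - 1"
  shows "\<exists>\<epsilon>>0. (\<lambda>n. real (ex_mat B n)) \<in> \<Omega>(\<lambda>n. real n powr (1 + \<epsilon>))"
proof -
  define k where "k = r + c"
  \<comment> \<open>This value solves \<open>k * \<epsilon> = 1 + \<epsilon>\<close>, which gives
    the gain and the loss below the same order.\<close>
  define \<epsilon> where "\<epsilon> = 1 / (real k - 1)"
  have k: "k \<ge> 2" using assms by (simp add: k_def)
  have w: "weight B \<ge> k" "weight B > 0" using assms by (auto simp: k_def)
  have \<epsilon>: "\<epsilon> > 0" "\<epsilon> \<le> 1" using k by (auto simp: \<epsilon>_def)
  have "1 / 4 * real n powr (1 + \<epsilon>) \<le> real (ex_mat B n)" if n: "n \<ge> 1" for n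
  proof -
    \<comment> \<open>Here \<open>n * p\<close> is \<open>n powr \<epsilon> / 2\<close>. The factor
      1/2 keeps the loss at no more than half of the gain.\<close>
    define p where "p = real n powr (\<epsilon> - 1) / 2"
    have "real n powr (\<epsilon> - 1) \<le> real n powr 0"
      using n \<epsilon> by (intro powr_mono) auto
    then have p: "0 \<le> p" "p \<le> 1" using n by (auto simp: p_def)
    have "real n ^ 2 * p = real n powr 2 * real n powr (\<epsilon> - 1) / 2"
      using n by (simp add: p_def powr_numeral)
    also have "\<dots> = real n powr (1 + \<epsilon>) / 2"
      by (simp only: powr_add[symmetric]) simp
    finally have "real n ^ 2 * p = real n powr (1 + \<epsilon>) / 2" .
    moreover have "real n ^ k * p ^ weight B \<le> real n powr (1 + \<epsilon>) / 4"
    proof -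
      have "k * \<epsilon> = 1 + \<epsilon>" using k by (simp add: \<epsilon>_def field_simps)
      \<comment> \<open>The weight hypothesis enters here: since \<open>p \<le> 1\<close>, the
        exponent may be lowered to \<open>k\<close>.\<close>
      have "real n ^ k * p ^ weight B \<le> real n ^ k * p ^ k"
        using p w by (intro mult_left_mono power_decreasing) auto
      also have "\<dots> = (real n * p) ^ k" by (simp add: power_mult_distrib)
      also have "real n * p = real n powr \<epsilon> / 2"
        using n by (simp add: p_def powr_diff)
      also have "(real n powr \<epsilon> / 2) ^ k = real n powr (1 + \<epsilon>) / 2 ^ k"
        using n \<open>k * \<epsilon> = 1 + \<epsilon>\<close> by (simp add: power_divide powr_power mult.commute)
      also have "\<dots> \<le> real n powr (1 + \<epsilon>) / 2 ^ 2"
        using k by (intro divide_left_mono power_increasing) auto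
      finally show ?thesis by simp
    qed
    ultimately show ?thesis
      using ex_mat_lower_bound[OF assms(3) w(2) p, of n] by (simp add: k_def)
  qed
  then have "(\<lambda>n. real (ex_mat B n)) \<in> \<Omega>(\<lambda>n. real n powr (1 + \<epsilon>))"
    by (intro landau_omega.bigI[of "1 / 4"] eventually_at_top_linorderI[of 1]) auto
  with \<epsilon>(1) show ?thesis by blast
qed

end
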